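(* Assume that the discrete kernels $A^{(n,\nu)}_{n-k}$ and the time mesh satisfy conditions A1, A2, A3 stated in the context, let $0\le\nu<1/2$, and let $(\xi^n)_{n=1}^N$, $(\eta^n)_{n=1}^N$ and $(\lambda_l)_{l=0}^{N-1}$ be given non-negative sequences. Assume further that there exists a constant $\Lambda$ (independent of the step sizes) such that $\Lambda\ge\sum_{l=0}^{N-1}\lambda_l$, and that the maximum step size satisfies $$\tau\le\frac{1}{\sqrt[\alpha]{2\pi_A\Gamma(2-\alpha)\Lambda}}.$$ Let $(v^k)_{k=0}^N$ be any non-negative sequence such that either $$\sum_{k=1}^nA^{(n,\nu)}_{n-k}\Big[(v^k)^2-(v^{k-1})^2\Big]\le\sum_{k=1}^n\lambda_{n-k}\big(v^{k-\nu}\big)^2+v^{n-\nu}\xi^n+(\eta^n)^2\quad\text{for }1\le n\le N,$$ or $$(v^n)^2\le(v^0)^2+\sum_{j=1}^nP^{(n,\nu)}_{n-j}\sum_{k=1}^j\lambda_{j-k}\big(v^{k-\nu}\big)^2+\sum_{j=1}^nP^{(n,\nu)}_{n-j}v^{j-\nu}\xi^j+\sum_{j=1}^nP^{(n,\nu)}_{n-j}(\eta^j)^2\quad\text{for }1\le n\le N.$$ Then, for $1\le n\le N$, $$v^n\le2E_\alpha\big(2\max\{1,\rho\}\pi_A\Lambda t_n^\alpha\big)\Big(v^0+\max_{1\le k\le n}\sum_{j=1}^kP^{(k,\nu)}_{k-j}\xi^j+\sqrt{\pi_A\Gamma(1-\alpha)}\max_{1\le k\le n}\big\{t_k^{\a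lpha/2}\eta^k\big\}\Big).$$
   Context: Fix $0<\alpha<1$ and $T>0$. The time mesh is $0=t_0<t_1<\dots<t_N=T$, with step sizes $\tau_k=t_k-t_{k-1}$, step ratios $\rho_k=\tau_k/\tau_{k+1}$ for $1\le k\le N-1$, and maximum step size $\tau=\max_{1\le k\le N}\tau_k$. For $\nu\in[0,1/2)$ and a sequence $(v^k)$, put $v^{k-\nu}=\nu v^{k-1}+(1-\nu)v^k$ for $k\ge1$. Let $\omega_\beta(t)=t^{\beta-1}/\Gamma(\beta)$. $E_\alpha(z)=\sum_{k=0}^\infty z^k/\Gamma(1+k\alpha)$ is the Mittag-Leffler function. For each $1\le n\le N$ real discrete kernels $A^{(n,\nu)}_{n-k}$, $1\le k\le n$, are given. The conditions are: A1. The kernels are monotone, $A^{(n,\nu)}_{k-2}\ge A^{(n,\nu)}_{k-1}>0$ for $2\le k\le n\le N$, and $(1-2\nu)A^{(n,\nu)}_0-(1-\nu)A^{(n,\nu)}_1\ge0$ (for $2\le n\le N$). A2. There is a constant $\pi_A>0$ such that $A^{(n,\nu)}_{n-k}\ge\frac1{\pi_A\tau_k}\int_{t_{k-1}}^{t_k}\omega_{1-\alpha}(t_n-s)\,ds$ for $1\le k\le n\le N$. A3. There is a constant $\rho>0$ such that $\rho_k\le\rho$ for $1\le k\le N-1$. The complementary discrete convolution kernels $P^{(n,\nu)}_{n-j}$, $1\le j\le n\le N$, are defined recursively by $P^{(n,\nu)}_0=1/A^{(n,\nu)}_0$ and $$P^{(n,\nu)}_{n-j}=\frac1{A^{(j,\nu)}_0}\sum_{k=j+1}^n\big(A^{(k,\nu)}_{k-j-1}-A^{(k,\nu)}_{k-j}\big)P^{(n,\nu)}_{n-k}\quad(1\le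 j\le n-1);$$ equivalently, $\sum_{j=k}^nP^{(n,\nu)}_{n-j}A^{(j,\nu)}_{j-k}=1$ for $1\le k\le n\le N$. *)

theory Defs
  imports "HOL-Analysis.Analysis"
begin

text \<open>
  A mesh is a function \<open>t :: nat \<Rightarrow> real\<close> of which only \<open>t 0, \<dots>, t N\<close> matter.
  A doubly indexed kernel family is a function \<open>A\<close> where \<open>A n m\<close> stands for
  \<open>A\<^sup>(\<^sup>n\<^sup>,\<^sup>\<nu>\<^sup>)\<close> with lower index \<open>m\<close>; only \<open>1 \<le> n \<le> N\<close> and \<open>m < n\<close> matter.
  The parameter \<open>\<nu>\<close> is fixed, so it is not recorded as an argument of the kernels.
\<close>

definition is_mesh :: "nat \<Rightarrow> real \<Rightarrow> (nat \<Rightarrow> real) \<Rightarrow> bool" where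
  "is_mesh N T t \<longleftrightarrow> t 0 = 0 \<and> t N = T \<and> (\<forall>k<N. t k < t (Suc k))"

text \<open>Only used for \<open>k \<ge> 1\<close>, so the subtraction on indices never truncates.\<close>

definition step_size :: "(nat \<Rightarrow> real) \<Rightarrow> nat \<Rightarrow> real" where
  "step_size t k = t k - t (k - 1)"

definition step_ratio :: "(nat \<Rightarrow> real) \<Rightarrow> nat \<Rightarrow> real" where
  "step_ratio t k = step_size t k / step_size t (k + 1)"

definition max_step :: "nat \<Rightarrow> (nat \<Rightarrow> real) \<Rightarrow> real" where
  "max_step N t = (MAX k\<in>{1..N}. step_size t k)"

text \<open>The weighted value \<open>v\<^sup>k\<^sup>-\<^sup>\<nu>\<close>, used only for \<open>k \<ge> 1\<close>.\<close>

definition offset_value :: "real \<Rightarrow> (nat \<Rightarrow> real) \<Rightarrow> nat \<Rightarrow> real" where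
  "offset_value \<nu> v k = \<nu> * v (k - 1) + (1 - \<nu>) * v k"

definition omega :: "real \<Rightarrow> real \<Rightarrow> real" where
  "omega \<beta> s = s powr (\<beta> - 1) / Gamma \<beta>"

definition mittag_leffler :: "real \<Rightarrow> real \<Rightarrow> real" where
  "mittag_leffler \<alpha> z = (\<Sum>k. z ^ k / Gamma (1 + real k * \<alpha>))"

definition kernel_monotone :: "nat \<Rightarrow> real \<Rightarrow> (nat \<Rightarrow> nat \<Rightarrow> real) \<Rightarrow> bool" where
  "kernel_monotone N \<nu> A \<longleftrightarrow>
     (\<forall>n k. 2 \<le> k \<and> k \<le> n \<and> n \<le> N \<longrightarrow> A n (k - 2) \<ge> A n (k - 1) \<and> A n (k - 1) > 0) \<and>
     (\<forall>n. 2 \<le> n \<and> n \<le> N \<longrightarrow> (1 - 2 * \<nu>) * A n 0 - (1 - \<nu>) * A n 1 \<ge> 0)"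

text \<open>
  For \<open>k = n\<close> the integrand has an integrable singularity at the right endpoint.
\<close>

definition kernel_lower_bound ::
    "nat \<Rightarrow> real \<Rightarrow> (nat \<Rightarrow> real) \<Rightarrow> real \<Rightarrow> (nat \<Rightarrow> nat \<Rightarrow> real) \<Rightarrow> bool" where
  "kernel_lower_bound N \<alpha> t \<pi>\<^sub>A A \<longleftrightarrow>
     (\<forall>n k. 1 \<le> k \<and> k \<le> n \<and> n \<le> N \<longrightarrow>
        A n (n - k) \<ge> 1 / (\<pi>\<^sub>A * step_size t k)
                      * integral {t (k - 1)..t k} (\<lambda>s. omega (1 - \<alpha>) (t n - s)))"

definition step_ratios_bounded :: "nat \<Rightarrow> (nat \<Rightarrow> real) \<Rightarrow> real \<Rightarrow> bool" where
  "step_ratios_bounded N t \<rho> \<longleftrightarrow> (\<forall>k. 1 \<le> k \<and> k \<le> N - 1 \<longrightarrow> step_ratio t k \<le> \<rho>)"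

text \<open>
  Complementary discrete convolution kernels: \<open>compl_kernel A n m\<close> is \<open>P\<^sup>(\<^sup>n\<^sup>,\<^sup>\<nu>\<^sup>)\<close> with
  lower index \<open>m = n - j\<close>, so that \<open>j = n - m\<close>. Values for \<open>m \<ge> n\<close> have no meaning.
\<close>

function compl_kernel :: "(nat \<Rightarrow> nat \<Rightarrow> real) \<Rightarrow> nat \<Rightarrow> nat \<Rightarrow> real" where
  "compl_kernel A n m =
     (if m = 0 then 1 / A n 0
      else let j = n - m in
        1 / A j 0 * (\<Sum>k\<in>{j+1..n}. (A k (k - j - 1) - A k (k - j)) * compl_kernel A n (n - k)))"
  by pat_completeness auto
termination
  by (relation "Wellfounded.measure (\<lambda>(A, n, m). m)") auto

declare compl_kernel.simps [simp del]

end

theory Submission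
  imports Defs
begin

text \<open>
  The convolution of \<open>omega (1 - \<alpha>)\<close> with \<open>omega \<beta>\<close> is \<open>omega (1 - \<alpha> + \<beta>)\<close>. On each mesh cell
  the kernels dominate the averages of \<open>omega (1 - \<alpha>)\<close>, so the convolution is at most a discrete
  convolution of the kernels with increments of \<open>omega (\<beta> + 1)\<close>: by Chebyshev's integral
  inequality if \<open>\<beta> \<le> 1\<close>, and by shifting the increments one cell to the right, at the cost of the
  step ratio, if \<open>\<beta> \<ge> 1\<close>. The complementary kernels turn this into a bound of their convolution
  with \<open>omega (1 - \<alpha> + \<beta>)\<close> by \<open>omega (\<beta> + 1)\<close>. Summing over \<open>\<beta> = \<alpha>, 2\<alpha>, \<dots>\<close> shows that the
  Mittag-Leffler function is a discrete supersolution of the Gronwall inequality, which then follows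
  by induction on \<open>n\<close>. Only an index \<open>n\<close> at which \<open>v\<close> exceeds all its earlier values matters; there
  the quadratic inequality can be divided by \<open>v n\<close>, and the step size restriction absorbs the last
  term of the convolution.
\<close>

section \<open>The functions \<open>omega\<close>: derivatives, integrals and convolution\<close>

lemma omega_nonneg: "0 < \<beta> \<Longrightarrow> 0 \<le> omega \<beta> s"
  by (simp add: omega_def Gamma_real_pos less_imp_le)

lemma omega_pos: "0 < \<beta> \<Longrightarrow> 0 < s \<Longrightarrow> 0 < omega \<beta> s"
  by (simp add: omega_def Gamma_real_pos)

lemma omega_mono: "1 \<le> \<beta> \<Longrightarrow> 0 \<le> s \<Longrightarrow> s \<le> u \<Longrightarrow> omega \<beta> s \<le> omega \<beta> u"
  unfolding omega_def by (intro divide_right_mono powr_mono2) (auto simp: less_imp_le)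

lemma omega_antimono:
  "0 < \<beta> \<Longrightarrow> \<beta> \<le> 1 \<Longrightarrow> 0 < s \<Longrightarrow> s \<le> u \<Longrightarrow> omega \<beta> u \<le> omega \<beta> s"
  unfolding omega_def by (intro divide_right_mono powr_mono2') (auto simp: less_imp_le)

lemma Gamma_Suc_real: "0 < (x::real) \<Longrightarrow> Gamma (x + 1) = x * Gamma x"
  by (rule Gamma_plus1) (auto elim!: nonpos_Ints_cases)

lemma omega_has_real_derivative:
  assumes "0 < \<beta>" "0 < s"
  shows "(omega (\<beta> + 1) has_real_derivative omega \<beta> s) (at s)"
proof -
  have "((\<lambda>x. x powr \<beta> / Gamma (\<beta> + 1)) has_real_derivative \<beta> * s powr (\<beta> - 1) / Gamma (\<beta> + 1)) (at s)"
    using assms Gamma_real_pos[of "\<beta> + 1"] by (auto intro!: derivative_eq_intros simp del: Gamma_real_pos)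
  moreover have "\<beta> * s powr (\<beta> - 1) / Gamma (\<beta> + 1) = omega \<beta> s"
    using assms by (simp add: omega_def Gamma_Suc_real)
  ultimately show ?thesis by (simp add: omega_def[abs_def])
qed

lemma continuous_on_omega:
  assumes "1 < \<beta>" shows "continuous_on {0..} (omega \<beta>)"
proof -
  have "continuous_on {0..} (\<lambda>s. s powr (\<beta> - 1) / Gamma \<beta>)"
    using assms Gamma_real_pos[of \<beta>]
    by (intro continuous_on_divide continuous_on_powr' continuous_on_id continuous_on_const)
       (auto simp del: Gamma_real_pos)
  then show ?thesis by (simp add: omega_def[abs_def])
qed

text \<open>For \<open>\<beta> < 1\<close> the integrand is unbounded near 0, so the fundamental
  theorem is used in the form that asks for a derivative only inside the interval and for continuity
  of the primitive up to its ends.\<close>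

lemma omega_has_integral:
  assumes "0 < \<beta>" "0 \<le> a" "a \<le> b"
  shows "(omega \<beta> has_integral omega (\<beta> + 1) b - omega (\<beta> + 1) a) {a..b}"
proof (rule fundamental_theorem_of_calculus_interior)
  show "continuous_on {a..b} (omega (\<beta> + 1))"
    using assms by (intro continuous_on_subset[OF continuous_on_omega]) auto
  fix x assume "x \<in> {a<..<b}"
  then show "(omega (\<beta> + 1) has_vector_derivative omega \<beta> x) (at x)"
    using omega_has_real_derivative[of \<beta> x] assms
    by (simp add: has_real_derivative_iff_has_vector_derivative)
qed (use assms in auto)

text \<open>Continuity holds up to \<open>s = c\<close>, where the integrand may be singular. This
  is what the fundamental theorem and the mean value theorem need on cells that end at
  \<open>c\<close>.\<close>

lemma omega_reflected_primitive:
  assumes "0 < \<beta>" "b \<le> c"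
  shows "continuous_on {a..b} (\<lambda>s. - omega (\<beta> + 1) (c - s))"
    and "s < c \<Longrightarrow> ((\<lambda>s. - omega (\<beta> + 1) (c - s)) has_real_derivative omega \<beta> (c - s)) (at s)"
proof -
  show "continuous_on {a..b} (\<lambda>s. - omega (\<beta> + 1) (c - s))"
    using assms
    by (intro continuous_intros continuous_on_compose2[OF continuous_on_omega]) auto
  assume "s < c"
  then show "((\<lambda>s. - omega (\<beta> + 1) (c - s)) has_real_derivative omega \<beta> (c - s)) (at s)"
    using assms
    by (auto intro!: derivative_eq_intros DERIV_chain2[OF omega_has_real_derivative])
qed

lemma omega_reflected_has_integral:
  assumes "0 < \<beta>" "a \<le> b" "b \<le> c"
  shows "((\<lambda>s. omega \<beta> (c - s)) has_integral omega (\<beta> + 1) (c - a) - omega (\<beta> + 1) (c - b)) {a..b}"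
proof -
  have "((\<lambda>s. omega \<beta> (c - s)) has_integral - omega (\<beta> + 1) (c - b) - (- omega (\<beta> + 1) (c - a))) {a..b}"
    using assms omega_reflected_primitive[of \<beta> b c]
    by (intro fundamental_theorem_of_calculus_interior)
       (auto simp flip: has_real_derivative_iff_has_vector_derivative)
  then show ?thesis by simp
qed

text \<open>The substitution \<open>s = t * x\<close> reduces the integral to Euler's Beta integral,
  and \<open>Beta b a = Gamma b * Gamma a / Gamma (b + a)\<close> cancels the normalising Gamma
  factors.\<close>

lemma omega_convolution:
  assumes "0 < a" "0 < b" "0 < t"
  shows "((\<lambda>s. omega a (t - s) * omega b s) has_integral omega (a + b) t) {0..t}"
proof -
  define c where "c = t powr (a - 1) * t powr (b - 1) / (Gamma a * Gamma b)"
  have "((\<lambda>x. x powr (b - 1) * (1 - x) powr (a - 1)) has_integral Beta b a) (cbox 0 1)"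
    using has_integral_Beta_real[of b a] assms by simp
  from has_integral_affinity'[OF this, of "1 / t" 0] assms
  have "((\<lambda>s. (s / t) powr (b - 1) * (1 - s / t) powr (a - 1)) has_integral Beta b a * t) {0..t}"
    by (simp add: field_simps)
  then have "((\<lambda>s. c * ((s / t) powr (b - 1) * (1 - s / t) powr (a - 1))) has_integral c * (Beta b a * t)) {0..t}"
    by (rule has_integral_mult_right)
  moreover have "c * ((s / t) powr (b - 1) * (1 - s / t) powr (a - 1)) = omega a (t - s) * omega b s"
    if "s \<in> {0..t}" for s
  proof -
    have "1 - s / t = (t - s) / t" using assms by (simp add: field_simps)
    then show ?thesis
      using that assms by (simp add: c_def omega_def powr_divide)
  qed
  moreover have "c * (Beta b a * t) = omega (a + b) t"
  proof -
    have "Gamma a > 0" "Gamma b > 0" using assms by auto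
    moreover have "t powr (a - 1) * t powr (b - 1) * t = t powr (a + b - 1)"
      using assms powr_mult_base[of t "a + b - 2"] by (simp add: powr_add[symmetric] algebra_simps)
    ultimately show ?thesis
      by (simp add: c_def omega_def Beta_def add.commute field_simps)
  qed
  ultimately show ?thesis
    using has_integral_eq[of "{0..t}" "\<lambda>s. c * ((s / t) powr (b - 1) * (1 - s / t) powr (a - 1))"]
    by simp
qed

section \<open>Chebyshev's integral inequality\<close>

text \<open>When \<open>f z\<close> is the mean of \<open>f\<close>, the product
  \<open>(f x - f z) * (g x - g z)\<close> is never positive and integrates to
  \<open>I - f z * J\<close>. Monotonicity is asked only inside the interval: since
  \<open>0 powr y = 0\<close>, an \<open>omega\<close> with negative exponent violates it at its
  singular endpoint.\<close>

lemma integral_chebyshev: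
  fixes f g F :: "real \<Rightarrow> real"
  assumes ab: "a < b"
    and F: "continuous_on {a..b} F" "\<And>x. x \<in> {a<..<b} \<Longrightarrow> (F has_real_derivative f x) (at x)"
    and f: "mono_on {a<..<b} f" and g: "antimono_on {a<..<b} g"
    and J: "(g has_integral J) {a..b}" and I: "((\<lambda>x. f x * g x) has_integral I) {a..b}"
  shows "I \<le> (F b - F a) / (b - a) * J"
proof -
  obtain z where z: "a < z" "z < b" "F b - F a = f z * (b - a)"
    using mvt[OF ab F(1), of "\<lambda>x. (*) (f x)"] F(2) by (auto simp: has_field_derivative_def)
  have "(f has_integral F b - F a) {a..b}"
    using ab F by (intro fundamental_theorem_of_calculus_interior)
       (auto simp flip: has_real_derivative_iff_has_vector_derivative)
  moreover have "((\<lambda>x. f z) has_integral f z * (b - a)) {a..b}"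
    using has_integral_const_real[of "f z" a b] ab by (simp add: mult.commute)
  ultimately have "((\<lambda>x. f x - f z) has_integral (F b - F a) - f z * (b - a)) {a..b}"
    by (rule has_integral_diff)
  then have "((\<lambda>x. f x - f z) has_integral 0) {a..b}"
    by (simp only: z(3) diff_self)
  then have "((\<lambda>x. g z * (f x - f z)) has_integral g z * 0) {a..b}"
    by (rule has_integral_mult_right)
  with I has_integral_mult_right[OF J, of "f z"]
  have "((\<lambda>x. (f x * g x - f z * g x) - g z * (f x - f z)) has_integral (I - f z * J) - g z * 0) {a..b}"
    by (intro has_integral_diff)
  then have "((\<lambda>x. (f x - f z) * (g x - g z)) has_integral I - f z * J) {a..b}"
    by (simp add: algebra_simps)
  then have "((\<lambda>x. (f x - f z) * (g x - g z)) has_integral I - f z * J) {a<..<b}"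
    by (simp add: has_integral_Icc_iff_Ioo)
  moreover have "(f x - f z) * (g x - g z) \<le> 0" if "x \<in> {a<..<b}" for x
  proof (cases "x \<le> z")
    case True
    then have "f x \<le> f z" "g z \<le> g x"
      using that z monotone_onD[OF f, of x z] monotone_onD[OF g, of x z] by auto
    then show ?thesis by (simp add: mult_nonpos_nonneg)
  next
    case False
    then have "f z \<le> f x" "g x \<le> g z"
      using that z monotone_onD[OF f, of z x] monotone_onD[OF g, of z x] by auto
    then show ?thesis by (simp add: mult_nonneg_nonpos)
  qed
  ultimately have "I - f z * J \<le> 0" using has_integral_le[OF _ has_integral_0] by blast
  then show ?thesis using z ab by simp
qed

section \<open>Convergence and monotonicity of the Mittag-Leffler series\<close>

text \<open>Log-convexity of Gamma between \<open>?y\<close> and \<open>?y + 1\<close> with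
  \<open>?y = x + \<alpha> - 1\<close>, since \<open>x\<close> is the convex combination with
  weights \<open>\<alpha>\<close> and \<open>1 - \<alpha>\<close>. It controls the quotient of
  successive Mittag-Leffler coefficients.\<close>

lemma Gamma_ratio_le:
  fixes x \<alpha> :: real
  assumes "0 < \<alpha>" "\<alpha> < 1" "1 \<le> x"
  shows "Gamma x \<le> (x + \<alpha> - 1) powr (- \<alpha>) * Gamma (x + \<alpha>)"
proof -
  let ?y = "x + \<alpha> - 1"
  have y: "0 < ?y" using assms by simp
  have "(ln \<circ> Gamma) ((1 - \<alpha>) *\<^sub>R (?y + 1) + \<alpha> *\<^sub>R ?y)
      \<le> (1 - \<alpha>) * (ln \<circ> Gamma) (?y + 1) + \<alpha> * (ln \<circ> Gamma) ?y"
    using assms y by (intro convex_onD[OF log_convex_Gamma_real]) auto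
  also have "(1 - \<alpha>) *\<^sub>R (?y + 1) + \<alpha> *\<^sub>R ?y = x" by (simp add: algebra_simps)
  also have "(ln \<circ> Gamma) (?y + 1) = ln ?y + ln (Gamma ?y)"
    using y Gamma_real_pos[OF y] by (simp only: o_def Gamma_Suc_real ln_mult_pos)
  finally have "ln (Gamma x) \<le> (1 - \<alpha>) * ln ?y + ln (Gamma ?y)"
    by (simp add: algebra_simps)
  then have "Gamma x \<le> exp ((1 - \<alpha>) * ln ?y + ln (Gamma ?y))"
    using assms Gamma_real_pos[of x] by (simp add: ln_le_cancel_iff[symmetric] del: ln_le_cancel_iff)
  also have "\<dots> = ?y powr (1 - \<alpha>) * Gamma ?y"
    using y Gamma_real_pos[of ?y] by (simp add: exp_add powr_def)
  also have "\<dots> = ?y powr (- \<alpha>) * (?y * Gamma ?y)"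
    using y powr_mult_base[of ?y "- \<alpha>"] by (simp add: mult.assoc[symmetric] mult.commute)
  also have "?y * Gamma ?y = Gamma (x + \<alpha>)"
    using Gamma_Suc_real[OF y] by simp
  finally show ?thesis .
qed

text \<open>Ratio test: by \<open>Gamma_ratio_le\<close> successive terms have a quotient of at most
  \<open>\<bar>z\<bar> * (real (Suc k) * \<alpha>) powr (- \<alpha>)\<close>, which tends to
  0.\<close>

lemma summable_mittag_leffler:
  fixes \<alpha> z :: real
  assumes "0 < \<alpha>" "\<alpha> < 1"
  shows "summable (\<lambda>k. z ^ k / Gamma (1 + real k * \<alpha>))"
proof -
  have lim: "((\<lambda>k. \<bar>z\<bar> * (real (Suc k) * \<alpha>) powr (- \<alpha>)) \<longlongrightarrow> \<bar>z\<bar> * 0) sequentially"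
    using assms
    by (intro tendsto_intros tendsto_neg_powr filterlim_at_top_mult_tendsto_pos[OF tendsto_const]
        filterlim_compose[OF filterlim_real_sequentially filterlim_Suc]) auto
  have "eventually (\<lambda>k. \<bar>z\<bar> * (real (Suc k) * \<alpha>) powr (- \<alpha>) < 1 / 2) sequentially"
    by (intro order_tendstoD(2)[OF lim]) simp
  then obtain K where K: "\<And>k. k \<ge> K \<Longrightarrow> \<bar>z\<bar> * (real (Suc k) * \<alpha>) powr (- \<alpha>) < 1 / 2"
    by (auto simp: eventually_sequentially)
  show ?thesis
  proof (rule summable_ratio_test[of "1 / 2" K])
    fix k assume "k \<ge> K"
    let ?x = "1 + real k * \<alpha>" and ?p = "(real (Suc k) * \<alpha>) powr (- \<alpha>)"
    have x: "1 \<le> ?x" "?x + \<alpha> - 1 = real (Suc k) * \<alpha>" "1 + real (Suc k) * \<alpha> = ?x + \<alpha>"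
      using assms by (auto simp: algebra_simps)
    have G: "Gamma ?x > 0" "Gamma (?x + \<alpha>) > 0" 
      using x(1) assms by (intro Gamma_real_pos; linarith)+
    have "Gamma ?x \<le> ?p * Gamma (?x + \<alpha>)"
      using Gamma_ratio_le[OF assms x(1)] unfolding x(2) .
    then have "1 / Gamma (?x + \<alpha>) \<le> ?p / Gamma ?x"
      using G by (simp add: field_simps)
    then have "\<bar>z\<bar> ^ Suc k * (1 / Gamma (?x + \<alpha>)) \<le> \<bar>z\<bar> ^ Suc k * (?p / Gamma ?x)"
      by (intro mult_left_mono) auto
    also have "\<dots> = (\<bar>z\<bar> * ?p) * (\<bar>z\<bar> ^ k / Gamma ?x)" by simp
    also have "\<dots> \<le> 1 / 2 * (\<bar>z\<bar> ^ k / Gamma ?x)"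
      using K[OF \<open>k \<ge> K\<close>] G by (intro mult_right_mono) auto
    finally show "norm (z ^ Suc k / Gamma (1 + real (Suc k) * \<alpha>)) \<le> 1 / 2 * norm (z ^ k / Gamma ?x)"
      unfolding x(3) using G by (simp add: abs_mult power_abs)
  qed simp
qed

lemma mittag_leffler_mono:
  fixes \<alpha> z w :: real
  assumes "0 < \<alpha>" "\<alpha> < 1" "0 \<le> z" "z \<le> w"
  shows "mittag_leffler \<alpha> z \<le> mittag_leffler \<alpha> w"
  unfolding mittag_leffler_def using assms
  by (intro suminf_le summable_mittag_leffler divide_right_mono power_mono)
     (auto intro!: less_imp_le[OF Gamma_real_pos] add_pos_nonneg)

lemma mittag_leffler_0: "mittag_leffler \<alpha> 0 = 1"
  using suminf_finite[of "{0}" "\<lambda>k. 0 ^ k / Gamma (1 + real k * \<alpha>)"]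
  by (simp add: mittag_leffler_def)

lemma mittag_leffler_ge_1:
  assumes "0 < \<alpha>" "\<alpha> < 1" "0 \<le> z"
  shows "1 \<le> mittag_leffler \<alpha> z"
  using mittag_leffler_mono[of \<alpha> 0 z] assms by (simp add: mittag_leffler_0)

section \<open>Mesh points and lower bounds for the kernels\<close>

locale fractional_kernels =
  fixes \<alpha> T \<nu> \<pi>\<^sub>A :: real and N :: nat and t :: "nat \<Rightarrow> real" and A :: "nat \<Rightarrow> nat \<Rightarrow> real"
  assumes \<alpha>: "0 < \<alpha>" "\<alpha> < 1" and mesh: "is_mesh N T t" and A1: "kernel_monotone N \<nu> A"
    and \<pi>_pos: "\<pi>\<^sub>A > 0" and A2: "kernel_lower_bound N \<alpha> t \<pi>\<^sub>A A"
begin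

abbreviation P :: "nat \<Rightarrow> nat \<Rightarrow> real" where "P \<equiv> compl_kernel A"
abbreviation \<tau> :: "nat \<Rightarrow> real" where "\<tau> \<equiv> step_size t"

lemma t_0: "t 0 = 0"
  using mesh by (simp add: is_mesh_def)

lemma t_less: "i < j \<Longrightarrow> j \<le> N \<Longrightarrow> t i < t j"
proof (induction j)
  case (Suc j)
  then have "t j < t (Suc j)" using mesh by (simp add: is_mesh_def)
  with Suc show ?case by (cases "i = j") auto
qed simp

lemma t_le: "i \<le> j \<Longrightarrow> j \<le> N \<Longrightarrow> t i \<le> t j"
  using t_less[of i j] by (cases "i = j") auto

lemma t_nonneg: "j \<le> N \<Longrightarrow> 0 \<le> t j"
  using t_le[of 0 j] t_0 by simp

lemma t_pos: "1 \<le> j \<Longrightarrow> j \<le> N \<Longrightarrow> 0 < t j"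
  using t_less[of 0 j] t_0 by simp

lemma step_pos: "1 \<le> k \<Longrightarrow> k \<le> N \<Longrightarrow> 0 < \<tau> k"
  using t_less[of "k - 1" k] by (simp add: step_size_def)

lemma kernel_integral:
  assumes "1 \<le> k" "k \<le> n" "n \<le> N"
  shows "((\<lambda>s. omega (1 - \<alpha>) (t n - s)) has_integral
           omega (2 - \<alpha>) (t n - t (k - 1)) - omega (2 - \<alpha>) (t n - t k)) {t (k - 1)..t k}"
  using omega_reflected_has_integral[of "1 - \<alpha>" "t (k - 1)" "t k" "t n"] \<alpha> assms t_le
  by simp

text \<open>This is A2 with the integral evaluated: the left side is the mean of
  \<open>omega (1 - \<alpha>) (t n - s)\<close> over the cell.\<close>

lemma kernel_ge:
  assumes "1 \<le> k" "k \<le> n" "n \<le> N"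
  shows "(omega (2 - \<alpha>) (t n - t (k - 1)) - omega (2 - \<alpha>) (t n - t k)) / \<tau> k \<le> \<pi>\<^sub>A * A n (n - k)"
proof -
  have "1 / (\<pi>\<^sub>A * \<tau> k) * (omega (2 - \<alpha>) (t n - t (k - 1)) - omega (2 - \<alpha>) (t n - t k)) \<le> A n (n - k)"
    using A2 assms integral_unique[OF kernel_integral[OF assms]]
    unfolding kernel_lower_bound_def by metis
  then show ?thesis
    using \<pi>_pos step_pos[of k] assms by (simp add: field_simps)
qed

text \<open>The mean over the cell is attained at an inner point, and the integrand increases with
  \<open>s\<close>, so its value at the left end of the cell is a lower bound.\<close>

lemma kernel_ge_omega:
  assumes "1 \<le> k" "k \<le> n" "n \<le> N"
  shows "omega (1 - \<alpha>) (t n - t (k - 1)) \<le> \<pi>\<^sub>A * A n (n - k)"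
proof -
  have lt: "t (k - 1) < t k" "t k \<le> t n" using assms t_less t_le by auto
  obtain z where z: "t (k - 1) < z" "z < t k"
    "- omega (1 - \<alpha> + 1) (t n - t k) - (- omega (1 - \<alpha> + 1) (t n - t (k - 1))) =
       omega (1 - \<alpha>) (t n - z) * (t k - t (k - 1))"
    using mvt[OF lt(1) omega_reflected_primitive(1)[of "1 - \<alpha>" "t k" "t n"],
        of "\<lambda>z. (*) (omega (1 - \<alpha>) (t n - z))"]
      omega_reflected_primitive(2)[of "1 - \<alpha>" "t k" "t n"] lt \<alpha>
    by (auto simp: has_field_derivative_def)
  have "omega (1 - \<alpha>) (t n - t (k - 1)) \<le> omega (1 - \<alpha>) (t n - z)"
    using z lt \<alpha> by (intro omega_antimono) auto
  also have "\<dots> = (omega (2 - \<alpha>) (t n - t (k - 1)) - omega (2 - \<alpha>) (t n - t k)) / \<tau> k"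
    using z lt by (simp add: step_size_def field_simps)
  also have "\<dots> \<le> \<pi>\<^sub>A * A n (n - k)" by (rule kernel_ge[OF assms])
  finally show ?thesis .
qed

text \<open>A2 gives positivity for all indices at once, including \<open>A 1 0\<close>, about which
  A1 makes no statement.\<close>

lemma kernel_pos:
  assumes "1 \<le> k" "k \<le> n" "n \<le> N"
  shows "0 < A n (n - k)"
proof -
  have "0 < omega (1 - \<alpha>) (t n - t (k - 1))"
    using assms \<alpha> t_less[of "k - 1" n] by (intro omega_pos) auto
  then have "0 < \<pi>\<^sub>A * A n (n - k)" using kernel_ge_omega[OF assms] by linarith
  then show ?thesis using \<pi>_pos by (simp add: zero_less_mult_iff)
qed

lemma kernel_decreasing:
  assumes "1 \<le> j" "j < k" "k \<le> N"
  shows "A k (k - j) \<le> A k (k - j - 1)"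
proof -
  have "A k ((k - j + 1) - 2) \<ge> A k ((k - j + 1) - 1)"
    using A1 assms unfolding kernel_monotone_def by (elim conjE allE[of _ k] allE[of _ "k - j + 1"]) auto
  moreover have "k - j + 1 - 2 = k - j - 1" "k - j + 1 - 1 = k - j" using assms by auto
  ultimately show ?thesis by simp
qed

section \<open>Complementary convolution kernels\<close>

lemma P_0: "P n 0 = 1 / A n 0"
  by (simp add: compl_kernel.simps)

lemma P_rec:
  assumes "j < n"
  shows "P n (n - j) = 1 / A j 0 * (\<Sum>k=Suc j..n. (A k (k - j - 1) - A k (k - j)) * P n (n - k))"
  using assms by (subst compl_kernel.simps) (simp add: Let_def)

text \<open>The differences in the recursion are nonnegative by A1, so nonnegativity propagates from
  \<open>P n 0\<close> by induction on \<open>n - j\<close>.\<close>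

lemma P_nonneg:
  assumes "n \<le> N"
  shows "1 \<le> j \<Longrightarrow> j \<le> n \<Longrightarrow> 0 \<le> P n (n - j)"
proof (induction "n - j" arbitrary: j rule: less_induct)
  case less
  have A0: "0 < A j 0" using kernel_pos[of j j] less.prems assms by simp
  show ?case
  proof (cases "j = n")
    case True
    then show ?thesis using A0 by (simp add: P_0)
  next
    case False
    then have "j < n" using less.prems by simp
    then show ?thesis unfolding P_rec[OF \<open>j < n\<close>]
      using A0 less assms kernel_decreasing[of j]
      by (intro mult_nonneg_nonneg sum_nonneg) auto
  qed
qed

text \<open>Downward induction on \<open>k\<close>: the recursion, multiplied by
  \<open>A k 0\<close>, says exactly that the sums for \<open>k\<close> and \<open>Suc k\<close>
  agree.\<close>

lemma P_convolution:
  assumes "1 \<le> k" "k \<le> n" "n \<le> N"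
  shows "(\<Sum>j=k..n. P n (n - j) * A j (j - k)) = 1"
  using assms(2,1)
proof (induction k rule: inc_induct)
  case base
  then show ?case using kernel_pos[of n n] assms by (simp add: P_0)
next
  case (step k)
  have "0 < A k 0" using kernel_pos[of k k] step.hyps step.prems assms by simp
  then have "P n (n - k) * A k 0 =
      (\<Sum>j=Suc k..n. P n (n - j) * A j (j - Suc k)) - (\<Sum>j=Suc k..n. P n (n - j) * A j (j - k))"
    unfolding P_rec[OF step.hyps(2)] by (simp add: sum_subtractf[symmetric] algebra_simps)
  moreover have "(\<Sum>j=k..n. P n (n - j) * A j (j - k)) =
      P n (n - k) * A k 0 + (\<Sum>j=Suc k..n. P n (n - j) * A j (j - k))"
    using step.hyps by (simp add: sum.atLeast_Suc_atMost)
  ultimately show ?case using step by simp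
qed

text \<open>After interchanging the sums, each \<open>w k\<close> carries the factor 1 from
  \<open>P_convolution\<close>. Thus \<open>P\<close> turns a convolution with the kernels into
  plain summation.\<close>

lemma P_sum:
  assumes "n \<le> N"
  shows "(\<Sum>j=1..n. P n (n - j) * (\<Sum>k=1..j. A j (j - k) * w k)) = (\<Sum>k=1..n. w k)"
proof -
  have "(\<Sum>j=1..n. P n (n - j) * (\<Sum>k=1..j. A j (j - k) * w k))
      = (\<Sum>j=1..n. \<Sum>k\<in>{k\<in>{1..n}. k \<le> j}. P n (n - j) * A j (j - k) * w k)"
    by (auto intro!: sum.cong simp: sum_distrib_left mult.assoc)
  also have "\<dots> = (\<Sum>k=1..n. \<Sum>j\<in>{j\<in>{1..n}. k \<le> j}. P n (n - j) * A j (j - k) * w k)"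
    by (rule sum.swap_restrict) auto
  also have "\<dots> = (\<Sum>k=1..n. (\<Sum>j=k..n. P n (n - j) * A j (j - k)) * w k)"
    by (auto intro!: sum.cong simp: sum_distrib_right)
  also have "\<dots> = (\<Sum>k=1..n. w k)"
    using P_convolution assms by (intro sum.cong) auto
  finally show ?thesis .
qed

text \<open>Variant without the last index, for the Gronwall argument, where the term
  \<open>j = n\<close> is treated separately.\<close>

lemma P_sum_less:
  assumes "1 \<le> n" "n \<le> N" and w: "\<And>k. 1 \<le> k \<Longrightarrow> k < n \<Longrightarrow> 0 \<le> w k"
  shows "(\<Sum>j=1..<n. P n (n - j) * (\<Sum>k=1..j. A j (j - k) * w k)) \<le> (\<Sum>k=1..<n. w k)"
proof -
  \<comment> \<open>Cutting \<open>w\<close> off at \<open>n\<close> allows the nonnegative term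
    \<open>j = n\<close> to be added without \<open>w n\<close>, which may refer to a point beyond
    the mesh.\<close>
  define u where "u k = (if k < n then w k else 0)" for k
  have n: "{1..n} = insert n {1..<n}" using assms by auto
  have "(\<Sum>j=1..<n. P n (n - j) * (\<Sum>k=1..j. A j (j - k) * w k))
      = (\<Sum>j=1..<n. P n (n - j) * (\<Sum>k=1..j. A j (j - k) * u k))"
    by (intro sum.cong refl arg_cong2[where f="(*)"]) (auto simp: u_def)
  also have "\<dots> \<le> (\<Sum>j=1..n. P n (n - j) * (\<Sum>k=1..j. A j (j - k) * u k))"
    using assms kernel_pos P_nonneg P_nonneg[of n n]
    by (intro sum_mono2 mult_nonneg_nonneg sum_nonneg) (auto simp: u_def less_imp_le)
  also have "\<dots> = (\<Sum>k=1..n. u k)" by (rule P_sum[OF assms(2)])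
  also have "\<dots> = (\<Sum>k=1..<n. w k)" unfolding n by (simp add: u_def)
  finally show ?thesis .
qed

text \<open>On the last cell the mean of the singular function is
  \<open>\<tau> n powr (- \<alpha>) / Gamma (2 - \<alpha>)\<close>. This is the source of
  \<open>Gamma (2 - \<alpha>)\<close> in the step size restriction.\<close>

lemma P_0_le:
  assumes "1 \<le> n" "n \<le> N"
  shows "P n 0 \<le> \<pi>\<^sub>A * Gamma (2 - \<alpha>) * \<tau> n powr \<alpha>"
proof -
  have \<tau>: "0 < \<tau> n" using assms by (simp add: step_pos)
  have A: "0 < A n 0" using kernel_pos[of n n] assms by simp
  have G: "0 < Gamma (2 - \<alpha>)" using \<alpha> by (intro Gamma_real_pos) simp
  have "omega (2 - \<alpha>) (\<tau> n) / \<tau> n \<le> \<pi>\<^sub>A * A n 0"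
    using kernel_ge[of n n] assms by (simp add: step_size_def omega_def)
  moreover have "\<tau> n powr (1 - \<alpha>) = \<tau> n / \<tau> n powr \<alpha>"
    using \<tau> by (simp add: powr_diff)
  ultimately have "1 / (\<tau> n powr \<alpha> * Gamma (2 - \<alpha>)) \<le> \<pi>\<^sub>A * A n 0"
    using \<tau> by (simp add: omega_def)
  then show ?thesis using A G \<tau> by (simp add: P_0 field_simps)
qed

text \<open>Since \<open>t 0 = 0\<close>, the value \<open>omega (1 - \<alpha>) (t j)\<close>
  belongs to the left end of the first cell and is dominated by the kernel with
  \<open>k = 1\<close>, whose complementary convolution is 1.\<close>

lemma P_sum_omega:
  assumes "1 \<le> n" "n \<le> N"
  shows "(\<Sum>j=1..n. P n (n - j) * omega (1 - \<alpha>) (t j)) \<le> \<pi>\<^sub>A"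
proof -
  have "(\<Sum>j=1..n. P n (n - j) * omega (1 - \<alpha>) (t j)) \<le> (\<Sum>j=1..n. P n (n - j) * (\<pi>\<^sub>A * A j (j - 1)))"
    using kernel_ge_omega[of 1] assms P_nonneg t_0
    by (intro sum_mono mult_left_mono) auto
  also have "\<dots> = \<pi>\<^sub>A * (\<Sum>j=1..n. P n (n - j) * A j (j - 1))"
    by (simp add: sum_distrib_left algebra_simps)
  finally show ?thesis using P_convolution[of 1 n] assms by simp
qed

section \<open>Convolution integrals estimated cell by cell\<close>

lemma integral_mesh:
  fixes f :: "real \<Rightarrow> real"
  assumes "j \<le> N" and f: "f integrable_on {0..t j}"
  shows "integral {0..t j} f = (\<Sum>k=1..j. integral {t (k - 1)..t k} f)"
  using assms
proof (induction j)
  case (Suc j)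
  have le: "0 \<le> t j" "t j \<le> t (Suc j)" using Suc.prems t_nonneg t_le by auto
  then have "f integrable_on {0..t j}"
    using Suc.prems(2) by (auto intro: integrable_on_subinterval)
  with Suc have "integral {0..t j} f = (\<Sum>k=1..j. integral {t (k - 1)..t k} f)" by simp
  then show ?case
    using Henstock_Kurzweil_Integration.integral_combine[OF le Suc.prems(2)] by simp
qed (simp add: t_0)

abbreviation product_integral :: "real \<Rightarrow> nat \<Rightarrow> nat \<Rightarrow> real" where
  "product_integral \<beta> j k \<equiv> integral {t (k - 1)..t k} (\<lambda>s. omega (1 - \<alpha>) (t j - s) * omega \<beta> s)"

lemma product_integral_sum:
  assumes "0 < \<beta>" "1 \<le> j" "j \<le> N"
  shows "omega (1 - \<alpha> + \<beta>) (t j) = (\<Sum>k=1..j. product_integral \<beta> j k)"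
  using omega_convolution[of "1 - \<alpha>" \<beta> "t j"] assms \<alpha> t_pos
  by (subst integral_mesh[symmetric]) (auto simp: integral_unique has_integral_integrable)

lemma product_has_integral:
  assumes "0 < \<beta>" "1 \<le> k" "k \<le> j" "j \<le> N"
  shows "((\<lambda>s. omega (1 - \<alpha>) (t j - s) * omega \<beta> s) has_integral product_integral \<beta> j k) {t (k - 1)..t k}"
proof -
  have "(\<lambda>s. omega (1 - \<alpha>) (t j - s) * omega \<beta> s) integrable_on {0..t j}"
    using omega_convolution[of "1 - \<alpha>" \<beta> "t j"] assms \<alpha> t_pos by (auto simp: has_integral_integrable)
  then have "(\<lambda>s. omega (1 - \<alpha>) (t j - s) * omega \<beta> s) integrable_on {t (k - 1)..t k}"
    by (rule integrable_on_subinterval) (use assms t_nonneg[of "k - 1"] t_le[of k j] in auto)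
  then show ?thesis by (rule integrable_integral)
qed

text \<open>For \<open>\<beta> \<le> 1\<close> one factor increases and the other decreases on the
  cell, so Chebyshev's inequality separates them: the mean of the first is bounded by A2, the
  integral of the second is the increment.\<close>

lemma product_integral_le_concave:
  assumes "0 < \<beta>" "\<beta> \<le> 1" "1 \<le> k" "k \<le> j" "j \<le> N"
  shows "product_integral \<beta> j k \<le>
           \<pi>\<^sub>A * (A j (j - k) * (omega (\<beta> + 1) (t k) - omega (\<beta> + 1) (t (k - 1))))"
proof -
  have lt: "0 \<le> t (k - 1)" "t (k - 1) < t k" "t k \<le> t j"
    using assms t_nonneg t_less t_le by auto
  have J: "(omega \<beta> has_integral omega (\<beta> + 1) (t k) - omega (\<beta> + 1) (t (k - 1))) {t (k - 1)..t k}"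
    using lt assms by (intro omega_has_integral) auto
  then have "0 \<le> omega (\<beta> + 1) (t k) - omega (\<beta> + 1) (t (k - 1))"
    by (rule has_integral_nonneg) (use assms omega_nonneg in auto)
  have "product_integral \<beta> j k \<le>
      (- omega (1 - \<alpha> + 1) (t j - t k) - (- omega (1 - \<alpha> + 1) (t j - t (k - 1)))) / (t k - t (k - 1))
        * (omega (\<beta> + 1) (t k) - omega (\<beta> + 1) (t (k - 1)))"
  proof (rule integral_chebyshev[OF lt(2) _ _ _ _ J product_has_integral])
    show "mono_on {t (k - 1)<..<t k} (\<lambda>s. omega (1 - \<alpha>) (t j - s))"
      using lt \<alpha> by (intro mono_onI omega_antimono) auto
    show "antimono_on {t (k - 1)<..<t k} (omega \<beta>)"
      using lt assms by (intro monotone_onI omega_antimono) auto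
    show "continuous_on {t (k - 1)..t k} (\<lambda>s. - omega (1 - \<alpha> + 1) (t j - s))"
      using lt \<alpha> by (intro omega_reflected_primitive) auto
    show "((\<lambda>s. - omega (1 - \<alpha> + 1) (t j - s)) has_real_derivative omega (1 - \<alpha>) (t j - x)) (at x)"
      if "x \<in> {t (k - 1)<..<t k}" for x
      using that lt \<alpha> by (intro omega_reflected_primitive(2)[of "1 - \<alpha>" "t k"]) auto
  qed (use assms in auto)
  also have "\<dots> \<le> (\<pi>\<^sub>A * A j (j - k)) * (omega (\<beta> + 1) (t k) - omega (\<beta> + 1) (t (k - 1)))"
    using kernel_ge[of k j] assms \<open>0 \<le> omega (\<beta> + 1) (t k) - omega (\<beta> + 1) (t (k - 1))\<close>
    by (intro mult_right_mono) (auto simp: step_size_def)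
  finally show ?thesis by (simp add: mult.assoc)
qed

text \<open>Here both factors increase and Chebyshev's inequality points the wrong way. Instead
  \<open>omega \<beta>\<close> is replaced by its value at \<open>t k\<close>, which is at most its
  mean over the next cell; exchanging \<open>\<tau> k\<close> for \<open>\<tau> (Suc k)\<close>
  costs the factor \<open>\<rho>\<close>. The next cell exists because \<open>j < N\<close>.\<close>

lemma product_integral_le_convex:
  assumes "1 \<le> \<beta>" "1 \<le> k" "k \<le> j" "j < N" and \<rho>: "step_ratios_bounded N t \<rho>" "0 < \<rho>"
  shows "product_integral \<beta> j k \<le>
           \<pi>\<^sub>A * \<rho> * (A j (j - k) * (omega (\<beta> + 1) (t (Suc k)) - omega (\<beta> + 1) (t k)))"
proof -
  have lt: "0 \<le> t (k - 1)" "t (k - 1) < t k" "t k \<le> t j" "t k < t (Suc k)"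
    using assms t_nonneg t_less t_le by auto
  have \<tau>: "0 < \<tau> k" "0 < \<tau> (Suc k)" using assms step_pos by auto
  have "step_ratio t k \<le> \<rho>" using assms \<rho> unfolding step_ratios_bounded_def by auto
  then have \<tau>_le: "\<tau> k \<le> \<rho> * \<tau> (Suc k)"
    using \<tau> by (simp add: step_ratio_def field_simps)
  let ?J = "omega (2 - \<alpha>) (t j - t (k - 1)) - omega (2 - \<alpha>) (t j - t k)"
  have "product_integral \<beta> j k \<le> ?J * omega \<beta> (t k)"
  proof (rule has_integral_le[OF product_has_integral has_integral_mult_left[OF kernel_integral]])
    fix s assume "s \<in> {t (k - 1)..t k}"
    then show "omega (1 - \<alpha>) (t j - s) * omega \<beta> s \<le> omega (1 - \<alpha>) (t j - s) * omega \<beta> (t k)"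
      using lt \<alpha> assms by (intro mult_left_mono omega_mono omega_nonneg) auto
  qed (use assms in auto)
  also have "?J \<le> \<pi>\<^sub>A * A j (j - k) * \<tau> k"
    using kernel_ge[of k j] assms \<tau> by (simp add: field_simps)
  also have "\<dots> \<le> \<pi>\<^sub>A * A j (j - k) * (\<rho> * \<tau> (Suc k))"
    using \<tau>_le kernel_pos[of k j] \<pi>_pos assms by (intro mult_left_mono) auto
  finally have 1: "product_integral \<beta> j k \<le> (\<pi>\<^sub>A * \<rho> * A j (j - k)) * (\<tau> (Suc k) * omega \<beta> (t k))"
    using assms omega_nonneg[of \<beta> "t k"] by (simp add: mult_right_mono algebra_simps)
  have "((\<lambda>s. omega \<beta> (t k)) has_integral \<tau> (Suc k) * omega \<beta> (t k)) {t k..t (Suc k)}"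
    using has_integral_const_real[of "omega \<beta> (t k)" "t k" "t (Suc k)"] lt by (simp add: step_size_def)
  moreover have "(omega \<beta> has_integral omega (\<beta> + 1) (t (Suc k)) - omega (\<beta> + 1) (t k)) {t k..t (Suc k)}"
    using lt assms by (intro omega_has_integral) auto
  ultimately have "\<tau> (Suc k) * omega \<beta> (t k) \<le> omega (\<beta> + 1) (t (Suc k)) - omega (\<beta> + 1) (t k)"
    by (rule has_integral_le) (use lt assms in \<open>auto intro: omega_mono\<close>)
  then have "(\<pi>\<^sub>A * \<rho> * A j (j - k)) * (\<tau> (Suc k) * omega \<beta> (t k)) \<le>
      (\<pi>\<^sub>A * \<rho> * A j (j - k)) * (omega (\<beta> + 1) (t (Suc k)) - omega (\<beta> + 1) (t k))"
    using \<pi>_pos \<rho> kernel_pos[of k j] assms by (intro mult_left_mono) auto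
  with 1 show ?thesis by (simp add: mult.assoc)
qed

text \<open>The cell estimates leave a complementary convolution of increments of
  \<open>omega (\<beta> + 1)\<close>, hence a telescoping sum. Stopping at \<open>j < n\<close>
  makes room for the shift when \<open>\<beta> > 1\<close>: the last shifted increment ends exactly
  at \<open>t n\<close>.\<close>

lemma P_sum_omega_le:
  assumes "0 < \<beta>" "1 \<le> n" "n \<le> N" and \<rho>: "step_ratios_bounded N t \<rho>" "0 < \<rho>"
  shows "(\<Sum>j=1..<n. P n (n - j) * omega (1 - \<alpha> + \<beta>) (t j)) \<le> max 1 \<rho> * \<pi>\<^sub>A * omega (\<beta> + 1) (t n)"
proof -
  \<comment> \<open>The argument common to both ranges of \<open>\<beta>\<close>: \<open>w\<close>
    stands for the increments and \<open>c\<close> for the constant in the cell estimate.\<close>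
  have bound: "(\<Sum>j=1..<n. P n (n - j) * omega (1 - \<alpha> + \<beta>) (t j)) \<le> max 1 \<rho> * \<pi>\<^sub>A * omega (\<beta> + 1) (t n)"
    if w: "\<And>j k. 1 \<le> k \<Longrightarrow> k \<le> j \<Longrightarrow> j < n \<Longrightarrow> product_integral \<beta> j k \<le> c * (A j (j - k) * w k)"
      and w0: "\<And>k. 1 \<le> k \<Longrightarrow> k < n \<Longrightarrow> 0 \<le> w k"
      and c: "0 \<le> c" "c \<le> max 1 \<rho> * \<pi>\<^sub>A" and le: "(\<Sum>k=1..<n. w k) \<le> omega (\<beta> + 1) (t n)" for w c
  proof -
    have "(\<Sum>j=1..<n. P n (n - j) * omega (1 - \<alpha> + \<beta>) (t j)) =
        (\<Sum>j=1..<n. P n (n - j) * (\<Sum>k=1..j. product_integral \<beta> j k))"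
      using assms by (intro sum.cong) (auto simp: product_integral_sum)
    also have "\<dots> \<le> (\<Sum>j=1..<n. P n (n - j) * (\<Sum>k=1..j. c * (A j (j - k) * w k)))"
      using P_nonneg assms by (intro sum_mono mult_left_mono w) auto
    also have "\<dots> = c * (\<Sum>j=1..<n. P n (n - j) * (\<Sum>k=1..j. A j (j - k) * w k))"
      by (simp add: sum_distrib_left[symmetric] algebra_simps)
    also have "\<dots> \<le> c * (\<Sum>k=1..<n. w k)"
      using assms w0 c by (intro mult_left_mono P_sum_less) auto
    also have "\<dots> \<le> max 1 \<rho> * \<pi>\<^sub>A * omega (\<beta> + 1) (t n)"
      using c le sum_nonneg[of "{1..<n}" w] w0 \<pi>_pos by (intro mult_mono) auto
    finally show ?thesis .
  qed
  have incr: "omega (\<beta> + 1) (t i) \<le> omega (\<beta> + 1) (t k)" if "i \<le> k" "k \<le> N" for i k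
    using that assms t_nonneg t_le by (intro omega_mono) auto
  have om0: "0 \<le> omega (\<beta> + 1) s" for s using assms by (intro omega_nonneg) simp
  show ?thesis
  proof (cases "\<beta> \<le> 1")
    case True
    show ?thesis
    proof (rule bound[of \<pi>\<^sub>A "\<lambda>k. omega (\<beta> + 1) (t k) - omega (\<beta> + 1) (t (k - 1))"])
      have "(\<Sum>k=1..<n. omega (\<beta> + 1) (t k) - omega (\<beta> + 1) (t (k - 1)))
          = omega (\<beta> + 1) (t (n - 1)) - omega (\<beta> + 1) (t 0)"
        using assms(2) by (induction n rule: dec_induct) auto
      also have "\<dots> \<le> omega (\<beta> + 1) (t n)" using incr[of "n - 1" n] om0[of "t 0"] assms by simp
      finally show "(\<Sum>k=1..<n. omega (\<beta> + 1) (t k) - omega (\<beta> + 1) (t (k - 1))) \<le> omega (\<beta> + 1) (t n)" .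
    qed (use True assms product_integral_le_concave incr \<pi>_pos in \<open>auto simp: mult_le_cancel_right1\<close>)
  next
    case False
    show ?thesis
    proof (rule bound[of "\<pi>\<^sub>A * \<rho>" "\<lambda>k. omega (\<beta> + 1) (t (Suc k)) - omega (\<beta> + 1) (t k)"])
      have "(\<Sum>k=1..<n. omega (\<beta> + 1) (t (Suc k)) - omega (\<beta> + 1) (t k))
          = omega (\<beta> + 1) (t n) - omega (\<beta> + 1) (t 1)"
        using assms(2) by (intro sum_Suc_diff')
      also have "\<dots> \<le> omega (\<beta> + 1) (t n)" using om0[of "t 1"] by simp
      finally show "(\<Sum>k=1..<n. omega (\<beta> + 1) (t (Suc k)) - omega (\<beta> + 1) (t k)) \<le> omega (\<beta> + 1) (t n)" .
      show "\<pi>\<^sub>A * \<rho> \<le> max 1 \<rho> * \<pi>\<^sub>A" using \<pi>_pos by (simp add: mult.commute)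
    qed (use False assms product_integral_le_convex incr \<pi>_pos in auto)
  qed
qed

section \<open>The Mittag-Leffler function as a discrete supersolution\<close>

text \<open>Convolution raises the order: \<open>P_sum_omega_le\<close> with
  \<open>\<beta> = (m + 1) * \<alpha>\<close> carries term \<open>m\<close> of the series to term
  \<open>m + 1\<close> at \<open>t n\<close>, and the factor \<open>\<mu>\<close> supplies the
  missing power. The shifted series lacks its leading 1, hence the \<open>- 1\<close> on the
  right.\<close>

lemma P_sum_mittag_leffler:
  assumes "0 \<le> \<mu>" "1 \<le> n" "n \<le> N" and \<rho>: "step_ratios_bounded N t \<rho>" "0 < \<rho>"
  shows "\<mu> * (\<Sum>j=1..<n. P n (n - j) * mittag_leffler \<alpha> (\<mu> * t j powr \<alpha>))
           \<le> max 1 \<rho> * \<pi>\<^sub>A * (mittag_leffler \<alpha> (\<mu> * t n powr \<alpha>) - 1)"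
proof -
  let ?e = "\<lambda>j m. (\<mu> * t j powr \<alpha>) ^ m / Gamma (1 + real m * \<alpha>)"
  have e: "?e j m = \<mu> ^ m * omega (1 + real m * \<alpha>) (t j)" if "1 \<le> j" "j \<le> N" for j m
    using t_pos[OF that] powr_power[of "t j" \<alpha> m] by (simp add: omega_def power_mult_distrib mult.commute)
  have sums: "summable (?e j)" for j by (rule summable_mittag_leffler[OF \<alpha>])
  have tail: "(\<Sum>m. ?e n (Suc m)) = mittag_leffler \<alpha> (\<mu> * t n powr \<alpha>) - 1"
    using suminf_split_head[OF sums[of n]] by (simp add: mittag_leffler_def)
  have sums': "summable (\<lambda>m. ?e n (Suc m))" using sums[of n] by (subst summable_Suc_iff)
  have "\<mu> * (\<Sum>j=1..<n. P n (n - j) * mittag_leffler \<alpha> (\<mu> * t j powr \<alpha>))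
      = (\<Sum>j=1..<n. \<Sum>m. \<mu> * P n (n - j) * ?e j m)"
    unfolding mittag_leffler_def sum_distrib_left mult.assoc[symmetric]
    by (intro sum.cong refl suminf_mult[symmetric] sums)
  also have "\<dots> = (\<Sum>m. \<Sum>j=1..<n. \<mu> * P n (n - j) * ?e j m)"
    by (intro suminf_sum[symmetric] summable_mult sums)
  also have "\<dots> \<le> (\<Sum>m. max 1 \<rho> * \<pi>\<^sub>A * ?e n (Suc m))"
  proof (intro suminf_le summable_sum summable_mult sums sums')
    fix m
    have idx: "1 - \<alpha> + real (Suc m) * \<alpha> = 1 + real m * \<alpha>" "real (Suc m) * \<alpha> + 1 = 1 + real (Suc m) * \<alpha>"
      by (auto simp: algebra_simps)
    have "(\<Sum>j=1..<n. \<mu> * P n (n - j) * ?e j m)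
        = \<mu> ^ Suc m * (\<Sum>j=1..<n. P n (n - j) * omega (1 + real m * \<alpha>) (t j))"
      using assms by (auto simp: sum_distrib_left e intro!: sum.cong)
    also have "\<dots> \<le> \<mu> ^ Suc m * (max 1 \<rho> * \<pi>\<^sub>A * omega (1 + real (Suc m) * \<alpha>) (t n))"
      using P_sum_omega_le[of "real (Suc m) * \<alpha>" n \<rho>] assms \<alpha> unfolding idx
      by (intro mult_left_mono) auto
    also have "\<dots> = max 1 \<rho> * \<pi>\<^sub>A * ?e n (Suc m)"
      using assms by (subst e) auto
    finally show "(\<Sum>j=1..<n. \<mu> * P n (n - j) * ?e j m) \<le> max 1 \<rho> * \<pi>\<^sub>A * ?e n (Suc m)" .
  qed
  also have "\<dots> = max 1 \<rho> * \<pi>\<^sub>A * (mittag_leffler \<alpha> (\<mu> * t n powr \<alpha>) - 1)"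
    unfolding tail[symmetric] by (rule suminf_mult[OF sums'])
  finally show ?thesis .
qed

end

section \<open>The discrete Gronwall inequality\<close>

lemma offset_value_nonneg:
  "0 \<le> \<nu> \<Longrightarrow> \<nu> \<le> 1 \<Longrightarrow> 0 \<le> v (k - 1) \<Longrightarrow> 0 \<le> v k \<Longrightarrow> 0 \<le> offset_value \<nu> v k"
  by (simp add: offset_value_def)

lemma offset_value_le:
  "0 \<le> \<nu> \<Longrightarrow> \<nu> \<le> 1 \<Longrightarrow> v (k - 1) \<le> c \<Longrightarrow> v k \<le> c \<Longrightarrow> offset_value \<nu> v k \<le> c"
  unfolding offset_value_def by (rule convex_bound_le) auto

text \<open>The weights that occur are \<open>lam 0\<close> up to \<open>lam (j - 1)\<close>, each
  once, so their total is at most \<open>\<Lambda>\<close>.\<close>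

lemma convolution_le:
  fixes lam b :: "nat \<Rightarrow> real"
  assumes "\<And>l. l < N \<Longrightarrow> 0 \<le> lam l" "(\<Sum>l<N. lam l) \<le> \<Lambda>" "j \<le> N" "0 \<le> c"
    and "\<And>k. 1 \<le> k \<Longrightarrow> k \<le> j \<Longrightarrow> b k \<le> c"
  shows "(\<Sum>k=1..j. lam (j - k) * b k) \<le> \<Lambda> * c"
proof -
  have "(\<Sum>k=1..j. lam (j - k) * b k) \<le> (\<Sum>k=1..j. lam (j - k) * c)"
    using assms by (intro sum_mono mult_left_mono) auto
  also have "\<dots> = (\<Sum>l<j. lam l) * c"
    unfolding sum_distrib_right
    by (rule sum.reindex_bij_witness[where i="\<lambda>l. j - l" and j="\<lambda>k. j - k"]) auto
  also have "\<dots> \<le> (\<Sum>l<N. lam l) * c"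
    using assms by (intro mult_right_mono sum_mono2) auto
  also have "\<dots> \<le> \<Lambda> * c" using assms by (intro mult_right_mono)
  finally show ?thesis .
qed

context fractional_kernels
begin

text \<open>Convolving with the complementary kernels telescopes the left side to
  \<open>(v n)\<^sup>2 - (v 0)\<^sup>2\<close>; nonnegativity of \<open>P\<close> preserves the
  inequality.\<close>

lemma convolved_form:
  assumes "1 \<le> n" "n \<le> N"
    and "\<And>j. 1 \<le> j \<Longrightarrow> j \<le> N \<Longrightarrow> (\<Sum>k=1..j. A j (j - k) * ((v k)\<^sup>2 - (v (k - 1))\<^sup>2)) \<le> r j"
  shows "(v n)\<^sup>2 \<le> (v 0)\<^sup>2 + (\<Sum>j=1..n. P n (n - j) * r j)"
proof -
  have "(v n)\<^sup>2 - (v 0)\<^sup>2 = (\<Sum>k=1..n. (v k)\<^sup>2 - (v (k - 1))\<^sup>2)"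
    by (induction n) auto
  also have "\<dots> = (\<Sum>j=1..n. P n (n - j) * (\<Sum>k=1..j. A j (j - k) * ((v k)\<^sup>2 - (v (k - 1))\<^sup>2)))"
    using P_sum[OF assms(2), of "\<lambda>k. (v k)\<^sup>2 - (v (k - 1))\<^sup>2"] by simp
  also have "\<dots> \<le> (\<Sum>j=1..n. P n (n - j) * r j)"
    using assms P_nonneg by (intro sum_mono mult_left_mono) auto
  finally show ?thesis by simp
qed

text \<open>The bound on \<open>\<eta>\<close> gives
  \<open>(\<eta> j)\<^sup>2 \<le> t j powr (- \<alpha>) * m\<^sup>2\<close>, and this power is
  \<open>Gamma (1 - \<alpha>) * omega (1 - \<alpha>) (t j)\<close>, to which
  \<open>P_sum_omega\<close> applies.\<close>

lemma P_sum_squares_le: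
  assumes "1 \<le> n" "n \<le> N" "0 \<le> m"
    and "\<And>j. 1 \<le> j \<Longrightarrow> j \<le> n \<Longrightarrow> 0 \<le> \<eta> j \<and> t j powr (\<alpha> / 2) * \<eta> j \<le> m"
  shows "(\<Sum>j=1..n. P n (n - j) * (\<eta> j)\<^sup>2) \<le> (sqrt (\<pi>\<^sub>A * Gamma (1 - \<alpha>)) * m)\<^sup>2"
proof -
  have G: "0 < Gamma (1 - \<alpha>)" using \<alpha> by simp
  have "(\<Sum>j=1..n. P n (n - j) * (\<eta> j)\<^sup>2)
      \<le> (\<Sum>j=1..n. P n (n - j) * (omega (1 - \<alpha>) (t j) * (Gamma (1 - \<alpha>) * m\<^sup>2)))"
  proof (intro sum_mono mult_left_mono)
    fix j assume j: "j \<in> {1..n}"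
    then have tj: "0 < t j" using assms t_pos by auto
    have "(t j powr (\<alpha> / 2) * \<eta> j)\<^sup>2 \<le> m\<^sup>2"
      using assms(4)[of j] j by (intro power_mono) auto
    moreover have "(t j powr (\<alpha> / 2))\<^sup>2 = t j powr \<alpha>"
      by (simp add: power2_eq_square powr_add[symmetric])
    ultimately have "t j powr \<alpha> * (\<eta> j)\<^sup>2 \<le> m\<^sup>2" by (simp add: power_mult_distrib)
    then have "(\<eta> j)\<^sup>2 \<le> t j powr (- \<alpha>) * m\<^sup>2"
      using tj by (simp add: powr_minus field_simps)
    also have "\<dots> = omega (1 - \<alpha>) (t j) * (Gamma (1 - \<alpha>) * m\<^sup>2)"
      using G by (simp add: omega_def)
    finally show "(\<eta> j)\<^sup>2 \<le> omega (1 - \<alpha>) (t j) * (Gamma (1 - \<alpha>) * m\<^sup>2)" .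
  qed (use P_nonneg assms in auto)
  also have "\<dots> = (\<Sum>j=1..n. P n (n - j) * omega (1 - \<alpha>) (t j)) * (Gamma (1 - \<alpha>) * m\<^sup>2)"
    by (simp add: sum_distrib_right mult.assoc)
  also have "\<dots> \<le> \<pi>\<^sub>A * (Gamma (1 - \<alpha>) * m\<^sup>2)"
    using P_sum_omega assms G by (intro mult_right_mono) auto
  also have "\<dots> = (sqrt (\<pi>\<^sub>A * Gamma (1 - \<alpha>)) * m)\<^sup>2"
    using G \<pi>_pos by (simp add: power_mult_distrib)
  finally show ?thesis .
qed

text \<open>The step size restriction is what makes the bound of \<open>P_0_le\<close>, times
  \<open>\<Lambda>\<close>, at most one half. It is assumed only for
  \<open>\<Lambda> \<noteq> 0\<close>, because its right side evaluates to 0 at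
  \<open>\<Lambda> = 0\<close>.\<close>

lemma P_0_mult_le_half:
  assumes "1 \<le> n" "n \<le> N" "0 \<le> \<Lambda>"
    and "\<Lambda> \<noteq> 0 \<Longrightarrow> max_step N t \<le> 1 / (2 * \<pi>\<^sub>A * Gamma (2 - \<alpha>) * \<Lambda>) powr (1 / \<alpha>)"
  shows "P n 0 * \<Lambda> \<le> 1 / 2"
proof (cases "\<Lambda> = 0")
  case False
  let ?c = "2 * \<pi>\<^sub>A * Gamma (2 - \<alpha>) * \<Lambda>"
  have c: "0 < ?c" using False assms \<pi>_pos \<alpha> by simp
  have "\<tau> n \<le> max_step N t" using assms unfolding max_step_def by (intro Max_ge) auto
  with assms(4) False have "\<tau> n \<le> 1 / ?c powr (1 / \<alpha>)" by linarith
  then have "\<tau> n powr \<alpha> \<le> (1 / ?c powr (1 / \<alpha>)) powr \<alpha>"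
    using \<alpha> step_pos[of n] assms by (intro powr_mono2) auto
  also have "\<dots> = 1 / ?c"
    using c \<alpha> by (simp add: powr_divide powr_powr)
  finally have "?c * \<tau> n powr \<alpha> \<le> 1" using c by (simp add: field_simps)
  moreover have "P n 0 * \<Lambda> \<le> \<pi>\<^sub>A * Gamma (2 - \<alpha>) * \<tau> n powr \<alpha> * \<Lambda>"
    using P_0_le assms by (intro mult_right_mono) auto
  ultimately show ?thesis by (simp add: algebra_simps)
qed simp

text \<open>The recursive inequality is required only at indices where \<open>v\<close> exceeds all
  earlier values: elsewhere the bound is inherited from an earlier index, as it grows with
  \<open>n\<close>. This lets the quadratic problem supply the inequality only where it can be
  divided by \<open>v n\<close>.\<close>

lemma gronwall_linear:
  fixes v b lam :: "nat \<Rightarrow> real"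
  assumes "0 \<le> \<nu>" "\<nu> \<le> 1" and \<rho>: "step_ratios_bounded N t \<rho>" "0 < \<rho>"
    and lam: "\<And>l. l < N \<Longrightarrow> 0 \<le> lam l" "(\<Sum>l<N. lam l) \<le> \<Lambda>"
    and step: "\<Lambda> \<noteq> 0 \<Longrightarrow> max_step N t \<le> 1 / (2 * \<pi>\<^sub>A * Gamma (2 - \<alpha>) * \<Lambda>) powr (1 / \<alpha>)"
    and v0: "\<And>n. 1 \<le> n \<Longrightarrow> n \<le> N \<Longrightarrow> v 0 \<le> b n"
    and b: "0 \<le> v 0" "\<And>m n. 1 \<le> m \<Longrightarrow> m \<le> n \<Longrightarrow> n \<le> N \<Longrightarrow> b m \<le> b n"
    and v: "\<And>n. \<lbrakk>1 \<le> n; n \<le> N; \<And>j. j < n \<Longrightarrow> v j < v n\<rbrakk> \<Longrightarrow>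
              v n \<le> b n + (\<Sum>j=1..n. P n (n - j) * (\<Sum>k=1..j. lam (j - k) * offset_value \<nu> v k))"
    and "1 \<le> n" "n \<le> N"
  shows "v n \<le> 2 * mittag_leffler \<alpha> (2 * max 1 \<rho> * \<pi>\<^sub>A * \<Lambda> * t n powr \<alpha>) * b n"
  using \<open>1 \<le> n\<close> \<open>n \<le> N\<close>
proof (induction n rule: less_induct)
  case (less n)
  let ?\<mu> = "2 * max 1 \<rho> * \<pi>\<^sub>A * \<Lambda>"
  let ?E = "\<lambda>j. mittag_leffler \<alpha> (?\<mu> * t j powr \<alpha>)"
  let ?S = "\<lambda>j. \<Sum>k=1..j. lam (j - k) * offset_value \<nu> v k"
  have \<Lambda>: "0 \<le> \<Lambda>" using lam sum_nonneg[of "{..<N}" lam] by fastforce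
  have \<mu>: "0 \<le> ?\<mu>" using \<Lambda> \<pi>_pos by simp
  have E1: "1 \<le> ?E j" if "j \<le> N" for j
    using mittag_leffler_ge_1[OF \<alpha>] \<mu> by simp
  have E_mono: "?E i \<le> ?E j" if "i \<le> j" "j \<le> N" for i j
    using that \<alpha> \<mu> t_nonneg t_le by (intro mittag_leffler_mono mult_left_mono powr_mono2) auto
  have b0: "0 \<le> b n" using v0[of n] b less.prems by linarith
  have E_b: "2 * ?E i * b i \<le> 2 * ?E j * b n" if "1 \<le> i" "i \<le> j" "j < n" for i j
    using that less.prems b v0[of i] E_mono[of i j] E1[of i] E1[of j]
    by (intro mult_mono) auto
  \<comment> \<open>The form with \<open>i \<le> j\<close> includes \<open>i = 0\<close>, because
    the offset value at \<open>k\<close> also involves \<open>v (k - 1)\<close>.\<close>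
  have IH: "v i \<le> 2 * ?E j * b n" if "i \<le> j" "j < n" for i j
  proof (cases "i = 0")
    case True
    have "1 * b n \<le> (2 * ?E j) * b n"
      by (rule mult_right_mono[OF _ b0]) (use E1[of j] that less.prems in linarith)
    with v0[OF less.prems] show ?thesis unfolding True mult_1 by (rule order_trans)
  next
    case False
    then have "v i \<le> 2 * ?E i * b i" using that less by auto
    also have "\<dots> \<le> 2 * ?E j * b n" using False that by (intro E_b) auto
    finally show ?thesis .
  qed
  show ?case
  proof (cases "\<exists>j<n. v n \<le> v j")
    case True
    then obtain j where j: "j < n" "v n \<le> v j" by blast
    have "2 * ?E j * b n \<le> 2 * ?E n * b n"
      using E_mono[of j n] j less.prems b0 by (intro mult_right_mono) auto
    then show ?thesis using IH[of j j] j by simp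
  next
    case False
    then have max: "v j < v n" if "j < n" for j using that by (meson not_le)
    have vn: "0 \<le> v n" using max[of 0] b less.prems by simp
    have "{1..n} = insert n {1..<n}" using less.prems by auto
    then have split: "(\<Sum>j=1..n. P n (n - j) * ?S j) = P n 0 * ?S n + (\<Sum>j=1..<n. P n (n - j) * ?S j)"
      by simp
    have "v k \<le> v n" if "k \<le> n" for k
      using that max[of k] by (cases "k = n") auto
    then have w_le: "offset_value \<nu> v k \<le> v n" if "1 \<le> k" "k \<le> n" for k
      using that assms(1,2) by (intro offset_value_le) auto
    \<comment> \<open>The term \<open>j = n\<close> contains \<open>v n\<close> itself, out of reach
      of the induction hypothesis; as \<open>v n\<close> is the largest value so far, this term is
      at most half of it.\<close>
    have "?S n \<le> \<Lambda> * v n"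
      using convolution_le[OF lam less.prems(2) vn w_le] .
    then have "P n 0 * ?S n \<le> P n 0 * (\<Lambda> * v n)"
      using P_nonneg[of n n] less.prems by (intro mult_left_mono) auto
    also have "\<dots> \<le> 1 / 2 * v n"
      unfolding mult.assoc[symmetric] using P_0_mult_le_half[OF less.prems \<Lambda> step] vn
      by (intro mult_right_mono) auto
    finally have last: "P n 0 * ?S n \<le> 1 / 2 * v n" .
    have "(\<Sum>j=1..<n. P n (n - j) * ?S j) \<le> (\<Sum>j=1..<n. P n (n - j) * (\<Lambda> * (2 * ?E j * b n)))"
    proof (intro sum_mono mult_left_mono)
      fix j assume j: "j \<in> {1..<n}"
      show "?S j \<le> \<Lambda> * (2 * ?E j * b n)"
      proof (rule convolution_le[of N])
        fix k assume "1 \<le> k" "k \<le> j"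
        then show "offset_value \<nu> v k \<le> 2 * ?E j * b n"
          using j assms(1,2) by (intro offset_value_le IH) auto
      qed (use lam j less.prems E1[of j] b0 in auto)
      show "0 \<le> P n (n - j)" using P_nonneg j less.prems by auto
    qed
    also have "\<dots> = 2 * \<Lambda> * (\<Sum>j=1..<n. P n (n - j) * ?E j) * b n"
      by (simp add: sum_distrib_left sum_distrib_right algebra_simps)
    also have "\<dots> \<le> (?E n - 1) * b n"
    proof (rule mult_right_mono[OF _ b0])
      \<comment> \<open>The argument of the Mittag-Leffler function is scaled so that the constant
        \<open>max 1 \<rho> * \<pi>\<^sub>A\<close> cancels and \<open>2 * \<Lambda>\<close>
        remains.\<close>
      have "(max 1 \<rho> * \<pi>\<^sub>A) * (2 * \<Lambda> * (\<Sum>j=1..<n. P n (n - j) * ?E j)) \<le> (max 1 \<rho> * \<pi>\<^sub>A) * (?E n - 1)"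
        using P_sum_mittag_leffler[OF \<mu> less.prems \<rho>] by (simp only: ac_simps)
      then show "2 * \<Lambda> * (\<Sum>j=1..<n. P n (n - j) * ?E j) \<le> ?E n - 1"
        using \<pi>_pos by (subst (asm) mult_le_cancel_left_pos) auto
    qed
    \<comment> \<open>Moving half of \<open>v n\<close> to the left gives the factor 2 of the
      claim.\<close>
    finally have "v n \<le> b n + 1 / 2 * v n + (?E n - 1) * b n"
      using v[OF less.prems max] split last by linarith
    then show ?thesis by (simp add: algebra_simps)
  qed
qed

end

section \<open>Reduction of the quadratic inequalities to the linear one\<close>

theorem theorem2p3:
  fixes \<alpha> T \<nu> \<pi>\<^sub>A \<rho> \<Lambda> :: real
    and N :: nat
    and t :: "nat \<Rightarrow> real"
    and A :: "nat \<Rightarrow> nat \<Rightarrow> real"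
    and \<xi> \<eta> lam v :: "nat \<Rightarrow> real"
  assumes "0 < \<alpha>" "\<alpha> < 1" and "0 < T"
    and "is_mesh N T t"
    and "0 \<le> \<nu>" "\<nu> < 1 / 2"
    and A1: "kernel_monotone N \<nu> A"
    and A2: "\<pi>\<^sub>A > 0" "kernel_lower_bound N \<alpha> t \<pi>\<^sub>A A"
    and A3: "\<rho> > 0" "step_ratios_bounded N t \<rho>"
    and "\<forall>n\<in>{1..N}. 0 \<le> \<xi> n" and "\<forall>n\<in>{1..N}. 0 \<le> \<eta> n"
    and "\<forall>l<N. 0 \<le> lam l"
    and "\<Lambda> \<ge> (\<Sum>l<N. lam l)"
    \<comment> \<open>for \<open>\<Lambda> = 0\<close> the bound on the step size is \<open>1 / 0\<close>, read as no restriction\<close>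
    and "\<Lambda> \<noteq> 0 \<Longrightarrow> max_step N t \<le> 1 / (2 * \<pi>\<^sub>A * Gamma (2 - \<alpha>) * \<Lambda>) powr (1 / \<alpha>)"
    and "\<forall>k\<le>N. 0 \<le> v k"
    and "(\<forall>n\<in>{1..N}.
            (\<Sum>k=1..n. A n (n - k) * ((v k)\<^sup>2 - (v (k - 1))\<^sup>2))
              \<le> (\<Sum>k=1..n. lam (n - k) * (offset_value \<nu> v k)\<^sup>2)
                 + offset_value \<nu> v n * \<xi> n + (\<eta> n)\<^sup>2)
       \<or> (\<forall>n\<in>{1..N}.
            (v n)\<^sup>2
              \<le> (v 0)\<^sup>2
                 + (\<Sum>j=1..n. compl_kernel A n (n - j)
                      * (\<Sum>k=1..j. lam (j - k) * (offset_value \<nu> v k)\<^sup>2))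
                 + (\<Sum>j=1..n. compl_kernel A n (n - j) * offset_value \<nu> v j * \<xi> j)
                 + (\<Sum>j=1..n. compl_kernel A n (n - j) * (\<eta> j)\<^sup>2))"
  shows "\<forall>n\<in>{1..N}.
           v n \<le> 2 * mittag_leffler \<alpha> (2 * max 1 \<rho> * \<pi>\<^sub>A * \<Lambda> * (t n) powr \<alpha>)
                  * (v 0
                     + (MAX k\<in>{1..n}. \<Sum>j=1..k. compl_kernel A k (k - j) * \<xi> j)
                     + sqrt (\<pi>\<^sub>A * Gamma (1 - \<alpha>)) * (MAX k\<in>{1..n}. (t k) powr (\<alpha> / 2) * \<eta> k))"
proof
  fix n assume n: "n \<in> {1..N}"
  interpret fractional_kernels \<alpha> T \<nu> \<pi>\<^sub>A N t A by unfold_locales fact+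
  note \<xi> = \<open>\<forall>n\<in>{1..N}. 0 \<le> \<xi> n\<close> and \<eta> = \<open>\<forall>n\<in>{1..N}. 0 \<le> \<eta> n\<close>
    and lam = \<open>\<forall>l<N. 0 \<le> lam l\<close> and v_nonneg = \<open>\<forall>k\<le>N. 0 \<le> v k\<close>
  have \<nu>: "0 \<le> \<nu>" "\<nu> \<le> 1" using \<open>0 \<le> \<nu>\<close> \<open>\<nu> < 1 / 2\<close> by auto
  let ?w = "offset_value \<nu> v"
  define X where "X k = (\<Sum>j=1..k. P k (k - j) * \<xi> j)" for k
  define Y where "Y k = t k powr (\<alpha> / 2) * \<eta> k" for k
  define C where "C = sqrt (\<pi>\<^sub>A * Gamma (1 - \<alpha>))"
  \<comment> \<open>All data terms together; \<open>b\<close> grows with \<open>n\<close> because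
    its maxima run over growing ranges.\<close>
  define b where "b n = v 0 + (MAX k\<in>{1..n}. X k) + C * (MAX k\<in>{1..n}. Y k)" for n
  have C: "0 \<le> C" using \<open>\<pi>\<^sub>A > 0\<close> \<open>\<alpha> < 1\<close> by (simp add: C_def)
  have X_le: "X k \<le> (MAX k\<in>{1..n}. X k)" and Y_le: "Y k \<le> (MAX k\<in>{1..n}. Y k)"
    if "1 \<le> k" "k \<le> n" for k n using that by (auto intro!: Max_ge)
  have X_nonneg: "0 \<le> X k" if "1 \<le> k" "k \<le> N" for k
    unfolding X_def using that \<xi> P_nonneg by (intro sum_nonneg mult_nonneg_nonneg) auto
  have Y_nonneg: "0 \<le> Y k" if "1 \<le> k" "k \<le> N" for k
    unfolding Y_def using that \<eta> by (intro mult_nonneg_nonneg) auto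
  have MY: "0 \<le> (MAX k\<in>{1..n}. Y k)" if "1 \<le> n" "n \<le> N" for n
    using order_trans[OF Y_nonneg[of 1] Y_le[of 1 n]] that by simp
  have MX: "0 \<le> (MAX k\<in>{1..n}. X k)" if "1 \<le> n" "n \<le> N" for n
    using order_trans[OF X_nonneg[of 1] X_le[of 1 n]] that by simp
  have w_nonneg: "0 \<le> ?w k" if "k \<le> N" for k
    using that v_nonneg \<nu> by (intro offset_value_nonneg) auto
  \<comment> \<open>Convolution with the complementary kernels brings the first alternative into the
    form of the second.\<close>
  have squares: "(v n)\<^sup>2 \<le> (v 0)\<^sup>2 + (\<Sum>j=1..n. P n (n - j) * (\<Sum>k=1..j. lam (j - k) * (?w k)\<^sup>2))
                 + (\<Sum>j=1..n. P n (n - j) * ?w j * \<xi> j) + (\<Sum>j=1..n. P n (n - j) * (\<eta> j)\<^sup>2)"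
    if n: "1 \<le> n" "n \<le> N" for n
    using assms(18)
  proof
    assume "\<forall>n\<in>{1..N}. (\<Sum>k=1..n. A n (n - k) * ((v k)\<^sup>2 - (v (k - 1))\<^sup>2))
              \<le> (\<Sum>k=1..n. lam (n - k) * (?w k)\<^sup>2) + ?w n * \<xi> n + (\<eta> n)\<^sup>2"
    then have "(v n)\<^sup>2 \<le> (v 0)\<^sup>2 + (\<Sum>j=1..n. P n (n - j) *
        ((\<Sum>k=1..j. lam (j - k) * (?w k)\<^sup>2) + ?w j * \<xi> j + (\<eta> j)\<^sup>2))"
      by (intro convolved_form n) auto
    then show ?thesis by (simp only: distrib_left sum.distrib mult.assoc add.assoc)
  qed (use n in auto)
  have "v n \<le> 2 * mittag_leffler \<alpha> (2 * max 1 \<rho> * \<pi>\<^sub>A * \<Lambda> * t n powr \<alpha>) * b n"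
  proof (rule gronwall_linear[OF \<nu> A3(2,1)])
    fix m n assume "1 \<le> m" "m \<le> n" "n \<le> N"
    then show "b m \<le> b n"
      unfolding b_def using C by (intro add_mono mult_left_mono Max_mono) auto
  next
    fix n assume n: "1 \<le> n" "n \<le> N" and max: "\<And>j. j < n \<Longrightarrow> v j < v n"
    \<comment> \<open>Strict positivity, from \<open>0 \<le> v 0 < v n\<close>, permits the final
      division by \<open>v n\<close>.\<close>
    have vn: "0 < v n" using max[of 0] v_nonneg n by fastforce
    have "v k \<le> v n" if "k \<le> n" for k
      using that max[of k] by (cases "k = n") auto
    then have w_le: "?w k \<le> v n" if "1 \<le> k" "k \<le> n" for k
      using that \<nu> by (intro offset_value_le) auto
    let ?L = "\<Sum>j=1..n. P n (n - j) * (\<Sum>k=1..j. lam (j - k) * ?w k)"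
    let ?M = "C * (MAX k\<in>{1..n}. Y k)"
    have M: "0 \<le> ?M" using C MY n by simp
    show "v n \<le> b n + ?L"
    \<comment> \<open>If \<open>v n\<close> is at most the contribution of \<open>\<eta>\<close>,
      the claim is immediate. Otherwise \<open>?M\<^sup>2 \<le> v n * ?M\<close>, so this square too
      can be divided by \<open>v n\<close>.\<close>
    proof (cases "v n \<le> ?M")
      case True
      have "0 \<le> ?L" using P_nonneg lam w_nonneg n by (intro sum_nonneg mult_nonneg_nonneg) auto
      then show ?thesis using True MX[OF n] v_nonneg unfolding b_def by fastforce
    next
      case False
      \<comment> \<open>Only one factor of each square is replaced by \<open>v n\<close>; the other
        one stays to form the linear convolution.\<close>
      have "(\<Sum>j=1..n. P n (n - j) * (\<Sum>k=1..j. lam (j - k) * (?w k)\<^sup>2))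
          \<le> (\<Sum>j=1..n. P n (n - j) * (\<Sum>k=1..j. lam (j - k) * (v n * ?w k)))"
        using P_nonneg lam w_nonneg w_le n unfolding power2_eq_square
        by (intro sum_mono mult_left_mono mult_right_mono) auto
      also have "\<dots> = v n * ?L" by (simp add: sum_distrib_left algebra_simps)
      finally have 1: "(\<Sum>j=1..n. P n (n - j) * (\<Sum>k=1..j. lam (j - k) * (?w k)\<^sup>2)) \<le> v n * ?L" .
      have "(\<Sum>j=1..n. P n (n - j) * ?w j * \<xi> j) \<le> (\<Sum>j=1..n. P n (n - j) * v n * \<xi> j)"
        using P_nonneg \<xi> w_le n by (intro sum_mono mult_left_mono mult_right_mono) auto
      also have "\<dots> = v n * X n" by (simp add: X_def sum_distrib_left algebra_simps)
      also have "\<dots> \<le> v n * (MAX k\<in>{1..n}. X k)" using X_le[of n n] n vn by (intro mult_left_mono) auto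
      finally have 2: "(\<Sum>j=1..n. P n (n - j) * ?w j * \<xi> j) \<le> v n * (MAX k\<in>{1..n}. X k)" .
      have "(\<Sum>j=1..n. P n (n - j) * (\<eta> j)\<^sup>2) \<le> ?M\<^sup>2"
        unfolding C_def using n MY \<eta> Y_le[unfolded Y_def] unfolding Y_def
        by (intro P_sum_squares_le) auto
      also have "\<dots> \<le> v n * ?M" using False M unfolding power2_eq_square by (intro mult_right_mono) auto
      finally have 3: "(\<Sum>j=1..n. P n (n - j) * (\<eta> j)\<^sup>2) \<le> v n * ?M" .
      have 4: "(v 0)\<^sup>2 \<le> v n * v 0"
        using max[of 0] n v_nonneg unfolding power2_eq_square by (intro mult_right_mono) auto
      have "v n * v n \<le> v n * (b n + ?L)"
        using squares[OF n] 1 2 3 4 unfolding b_def distrib_left power2_eq_square[of "v n"] by linarith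
      then show ?thesis using vn by simp
    qed
  next
    fix n assume n: "1 \<le> n" "n \<le> N"
    then show "v 0 \<le> b n" using MX MY C unfolding b_def by simp
  qed (use n lam v_nonneg assms(15,16) in auto)
  then show "v n \<le> 2 * mittag_leffler \<alpha> (2 * max 1 \<rho> * \<pi>\<^sub>A * \<Lambda> * (t n) powr \<alpha>)
                  * (v 0
                     + (MAX k\<in>{1..n}. \<Sum>j=1..k. compl_kernel A k (k - j) * \<xi> j)
                     + sqrt (\<pi>\<^sub>A * Gamma (1 - \<alpha>)) * (MAX k\<in>{1..n}. (t k) powr (\<alpha> / 2) * \<eta> k))"
    by (simp add: b_def X_def Y_def C_def)
qed

end
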